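(* There exist a constant $c>0$ and, for infinitely many positive integers $n$, an $n$-vertex biconnected outerplanar graph $G_n$ such that every convex grid drawing of $G_n$ has area at least $c\,n^{3}$. (That is, there exists an $n$-vertex biconnected outerplanar graph that requires $\Omega(n^3)$ area in every convex grid drawing.)
   Context: A graph is outerplanar if it admits a planar drawing in which every vertex is incident to the outer (unbounded) face. A grid drawing of a graph maps vertices to distinct points with integer coordinates. A straight-line drawing draws each edge as the segment between its endpoints; it is planar if no two edges intersect except at a common endpoint. A convex drawing is a planar straight-line drawing in which the boundary of every face, including the outer face, is a convex polygon, i.e. a polygon all of whose internal angles are at most $180^\circ$ (the drawing is not required to be outerplanar or to respect any prescribed embedding). For a grid drawing $\Gamma$, its width is $\max_x(\Gamma)-\min_x(\Gamma)+1$ and its height is $\max_y(\Gamma)-\min_y(\Gamma)+1$, where $\max_q,\min_q$ denote the maximum and minimum $q$-coordinate of a vertex; the area is width times height. *)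

theory Defs
  imports "HOL-Analysis.Analysis"
begin

definition simple_graph :: "'v set \<Rightarrow> 'v set set \<Rightarrow> bool" where
  "simple_graph V E \<longleftrightarrow> finite V \<and> (\<forall>e\<in>E. e \<subseteq> V \<and> card e = 2)"

definition graph_connected :: "'v set \<Rightarrow> 'v set set \<Rightarrow> bool" where
  "graph_connected V E \<longleftrightarrow>
     (\<forall>u\<in>V. \<forall>w\<in>V. (\<lambda>x y. x \<in> V \<and> y \<in> V \<and> {x, y} \<in> E)\<^sup>*\<^sup>* u w)"

definition biconnected :: "'v set \<Rightarrow> 'v set set \<Rightarrow> bool" where
  "biconnected V E \<longleftrightarrow> graph_connected V E \<and> (\<forall>v\<in>V. graph_connected (V - {v}) E)"

definition planar_drawing ::
  "'v set \<Rightarrow> 'v set set \<Rightarrow> ('v \<Rightarrow> real \<times> real) \<Rightarrow> ('v set \<Rightarrow> real \<Rightarrow> real \<times> real) \<Rightarrow> bool" where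
  "planar_drawing V E pos arc_of \<longleftrightarrow>
     inj_on pos V \<and>
     (\<forall>e\<in>E. arc (arc_of e) \<and> {pathstart (arc_of e), pathfinish (arc_of e)} = pos ` e) \<and>
     (\<forall>e\<in>E. \<forall>v\<in>V. pos v \<in> path_image (arc_of e) \<longrightarrow> v \<in> e) \<and>
     (\<forall>e1\<in>E. \<forall>e2\<in>E. e1 \<noteq> e2 \<longrightarrow>
        path_image (arc_of e1) \<inter> path_image (arc_of e2) \<subseteq> pos ` (e1 \<inter> e2))"

definition drawing_set ::
  "'v set \<Rightarrow> 'v set set \<Rightarrow> ('v \<Rightarrow> real \<times> real) \<Rightarrow> ('v set \<Rightarrow> real \<Rightarrow> real \<times> real) \<Rightarrow> (real \<times> real) set" where
  "drawing_set V E pos arc_of = pos ` V \<union> (\<Union>e\<in>E. path_image (arc_of e))"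

definition outerplanar :: "'v set \<Rightarrow> 'v set set \<Rightarrow> bool" where
  "outerplanar V E \<longleftrightarrow>
     (\<exists>pos arc_of. planar_drawing V E pos arc_of \<and>
        (\<forall>v\<in>V. \<exists>Fo \<in> components (- drawing_set V E pos arc_of).
                  \<not> bounded Fo \<and> pos v \<in> closure Fo))"

definition to_plane :: "int \<times> int \<Rightarrow> real \<times> real" where
  "to_plane q = (real_of_int (fst q), real_of_int (snd q))"

definition seg_of :: "('v \<Rightarrow> int \<times> int) \<Rightarrow> 'v set \<Rightarrow> (real \<times> real) set" where
  "seg_of p e = (\<Union>u\<in>e. \<Union>w\<in>e. closed_segment (to_plane (p u)) (to_plane (p w)))"

definition straight_planar_grid_drawing :: "'v set \<Rightarrow> 'v set set \<Rightarrow> ('v \<Rightarrow> int \<times> int) \<Rightarrow> bool" where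
  "straight_planar_grid_drawing V E p \<longleftrightarrow>
     inj_on p V \<and>
     (\<forall>e\<in>E. \<forall>v\<in>V. to_plane (p v) \<in> seg_of p e \<longrightarrow> v \<in> e) \<and>
     (\<forall>e1\<in>E. \<forall>e2\<in>E. e1 \<noteq> e2 \<longrightarrow>
        seg_of p e1 \<inter> seg_of p e2 \<subseteq> (to_plane \<circ> p) ` (e1 \<inter> e2))"

definition grid_drawing_set :: "'v set \<Rightarrow> 'v set set \<Rightarrow> ('v \<Rightarrow> int \<times> int) \<Rightarrow> (real \<times> real) set" where
  "grid_drawing_set V E p = (to_plane \<circ> p) ` V \<union> (\<Union>e\<in>E. seg_of p e)"

text \<open>Convex drawing: faces are the connected components of the complement of the drawing;
  every bounded (inner) face is a convex region, and the outer face is the complement of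
  a convex region (its boundary is a convex polygon).\<close>
definition convex_grid_drawing :: "'v set \<Rightarrow> 'v set set \<Rightarrow> ('v \<Rightarrow> int \<times> int) \<Rightarrow> bool" where
  "convex_grid_drawing V E p \<longleftrightarrow>
     straight_planar_grid_drawing V E p \<and>
     (\<forall>F \<in> components (- grid_drawing_set V E p).
        (bounded F \<longrightarrow> convex F) \<and> (\<not> bounded F \<longrightarrow> convex (- F)))"

definition grid_width :: "'v set \<Rightarrow> ('v \<Rightarrow> int \<times> int) \<Rightarrow> int" where
  "grid_width V p = Max ((fst \<circ> p) ` V) - Min ((fst \<circ> p) ` V) + 1"

definition grid_height :: "'v set \<Rightarrow> ('v \<Rightarrow> int \<times> int) \<Rightarrow> int" where
  "grid_height V p = Max ((snd \<circ> p) ` V) - Min ((snd \<circ> p) ` V) + 1"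

definition grid_area :: "'v set \<Rightarrow> ('v \<Rightarrow> int \<times> int) \<Rightarrow> int" where
  "grid_area V p = grid_width V p * grid_height V p"

end

theory Submission
  imports Defs
begin

text \<open>Attach an ear (a triangle) to all sides but one of an \<open>(m + 1)\<close>-cycle. In a convex drawing the tip
  of an ear has degree two and a strictly convex angle, and the reflex side of that angle can lie
  only in the outer face. As the complement of the outer face is convex, the tip is a strictly
  extreme point of the whole drawing. So the \<open>m\<close> tips are lattice points in strictly convex position,
  and such points need area \<open>\<Omega>(m\<^sup>3)\<close>: along a monotone quarter of their hull the edge vectors are
  distinct positive integer vectors, and only \<open>O(W H / m\<^sup>2)\<close> of these have both coordinates below
  a constant multiple of the average step lengths \<open>W / m\<close> and \<open>H / m\<close>.\<close>

subsection \<open>Lattice points in strictly convex position\<close>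

text \<open>At most a quarter of the steps are longer than \<open>4 * W / r\<close> in x, and at
  most a quarter longer than \<open>4 * H / r\<close> in y. So at least \<open>r / 2\<close>
  distinct vectors lie in a box with at most \<open>16 * W * H / r^2\<close> lattice points; hence
  the factor 32.\<close>

lemma distinct_positive_steps_area:
  fixes x y :: "nat \<Rightarrow> int" and W H :: int
  assumes dx: "\<And>i. i < r \<Longrightarrow> x i < x (Suc i)"
    and dy: "\<And>i. i < r \<Longrightarrow> y i < y (Suc i)"
    and inj: "inj_on (\<lambda>i. (x (Suc i) - x i, y (Suc i) - y i)) {..<r}"
    and W: "x r - x 0 \<le> W" and H: "y r - y 0 \<le> H"
  shows "int r ^ 3 \<le> 32 * W * H"
proof (cases "r = 0")
  case True
  then show ?thesis using W H by simp
next
  case False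
  define R where "R = int r"
  have R: "R > 0" using False by (simp add: R_def)
  \<comment> \<open>Markov's inequality for one coordinate: steps exceeding four times
    \<open>L / r\<close> would otherwise add up to more than \<open>L\<close>. Multiplying by
    \<open>R\<close> keeps everything in the integers.\<close>
  have few_long_steps: "4 * int (card {i\<in>{..<r}. 4 * L < (z (Suc i) - z i) * R}) \<le> R \<and> L > 0"
    if dz: "\<And>i. i < r \<Longrightarrow> z i < z (Suc i)" and L: "z r - z 0 \<le> L" for z :: "nat \<Rightarrow> int" and L
  proof -
    let ?B = "{i\<in>{..<r}. 4 * L < (z (Suc i) - z i) * R}"
    have tele: "(\<Sum>i<r. z (Suc i) - z i) = z r - z 0"
      by (rule sum_lessThan_telescope)
    have "(\<Sum>i<r. 1) \<le> (\<Sum>i<r. z (Suc i) - z i)"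
      by (rule sum_mono) (use dz in force)
    then have Lpos: "L > 0" using tele L R by (simp add: R_def)
    have "int (card ?B) * (4 * L) = (\<Sum>i\<in>?B. 4 * L)" by simp
    also have "\<dots> \<le> (\<Sum>i\<in>?B. (z (Suc i) - z i) * R)" by (rule sum_mono) auto
    also have "\<dots> \<le> (\<Sum>i<r. (z (Suc i) - z i) * R)"
      by (rule sum_mono2) (use dz R in \<open>auto simp: less_imp_le\<close>)
    also have "\<dots> = (z r - z 0) * R" by (simp add: tele flip: sum_distrib_right)
    also have "\<dots> \<le> L * R" using L R by simp
    finally have "L * (4 * int (card ?B)) \<le> L * R" by (simp add: algebra_simps)
    with Lpos show ?thesis by simp
  qed
  let ?Bx = "{i\<in>{..<r}. 4 * W < (x (Suc i) - x i) * R}"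
  let ?By = "{i\<in>{..<r}. 4 * H < (y (Suc i) - y i) * R}"
  let ?G = "{..<r} - (?Bx \<union> ?By)"
  let ?d = "\<lambda>i. (x (Suc i) - x i, y (Suc i) - y i)"
  \<comment> \<open>Side lengths of the box holding every step outside \<open>?Bx\<close> and
    \<open>?By\<close>; rounding down loses nothing since steps are integral.\<close>
  define A B where "A = 4 * W div R" and "B = 4 * H div R"
  note bx = few_long_steps[of x W, OF dx W] and bY = few_long_steps[of y H, OF dy H]
  have A: "0 \<le> A" "A * R \<le> 4 * W" and B: "0 \<le> B" "B * R \<le> 4 * H"
    using bx bY R by (auto simp: A_def B_def pos_imp_zdiv_nonneg_iff minus_mod_eq_div_mult[symmetric])
  have "r = card ?G + card (?Bx \<union> ?By)"
    using card_Diff_subset[of "?Bx \<union> ?By" "{..<r}"] card_mono[of "{..<r}" "?Bx \<union> ?By"] by fastforce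
  moreover have "card (?Bx \<union> ?By) \<le> card ?Bx + card ?By" by (rule card_Un_le)
  ultimately have G: "R \<le> 2 * int (card ?G)" using bx bY unfolding R_def by linarith
  have le_div: "d \<le> c div R" if "d * R \<le> c" for c d
    using zdiv_mono1[OF that R] R by simp
  have "?d ` ?G \<subseteq> {1..A} \<times> {1..B}"
    using dx dy by (fastforce simp: A_def B_def not_less int_one_le_iff_zero_less intro: le_div)
  then have "card (?d ` ?G) \<le> card ({1..A} \<times> {1..B})"
    by (intro card_mono) auto
  also have "card (?d ` ?G) = card ?G"
    by (rule card_image) (use inj in \<open>auto intro: inj_on_subset\<close>)
  finally have "int (card ?G) \<le> A * B"
    using A B by (simp add: card_cartesian_product flip: nat_mult_distrib) (simp add: le_nat_iff)
  with G have "R \<le> 2 * (A * B)" by linarith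
  then have "R * (R * R) \<le> 2 * (A * B) * (R * R)" using R by (intro mult_right_mono) auto
  also have "\<dots> = 2 * ((A * R) * (B * R))" by (simp add: algebra_simps)
  also have "(A * R) * (B * R) \<le> (4 * W) * (4 * H)"
    by (rule mult_mono) (use A B bx bY R in auto)
  finally show ?thesis by (simp add: R_def power3_eq_cube algebra_simps)
qed

text \<open>All supporting functionals point to the lower right, so the points form the lower right
  part of a convex hull: an increasing chain with strictly increasing slopes. Its
  \<open>card S - 1\<close> steps are therefore distinct positive vectors.\<close>

lemma quadrant_extreme_points_area:
  fixes S :: "(int \<times> int) set" and W H :: int
  assumes fin: "finite S" and nonempty: "S \<noteq> {}"
    and ext: "\<And>P. P \<in> S \<Longrightarrow> \<exists>a b::real. a \<ge> 0 \<and> b \<ge> 0 \<and>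
            (\<forall>Q\<in>S - {P}.
              a * real_of_int (fst Q) - b * real_of_int (snd Q) < a * real_of_int (fst P) - b * real_of_int (snd P))"
    and W: "\<And>P Q. P \<in> S \<Longrightarrow> Q \<in> S \<Longrightarrow> fst P - fst Q \<le> W"
    and H: "\<And>P Q. P \<in> S \<Longrightarrow> Q \<in> S \<Longrightarrow> snd P - snd Q \<le> H"
  shows "int (card S - 1) ^ 3 \<le> 32 * W * H"
proof -
  have mono: "fst P < fst Q \<and> snd P < snd Q"
    if "P \<in> S" "Q \<in> S" "P \<noteq> Q" "fst P \<le> fst Q" for P Q
  proof -
    from ext[OF that(1)] that obtain a b :: real where ab: "a \<ge> 0" "b \<ge> 0"
      "a * real_of_int (fst Q) - b * real_of_int (snd Q) < a * real_of_int (fst P) - b * real_of_int (snd P)" by fastforce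
    from ext[OF that(2)] that obtain c d :: real where cd: "c \<ge> 0" "d \<ge> 0"
      "c * real_of_int (fst P) - d * real_of_int (snd P) < c * real_of_int (fst Q) - d * real_of_int (snd Q)" by fastforce
    \<comment> \<open>\<open>P\<close> beats \<open>Q\<close> in its own functional without being
      further right, so it must be lower; then \<open>Q\<close>, being higher, can beat
      \<open>P\<close> in its functional only by being strictly further right.\<close>
    have "a * real_of_int (fst P) \<le> a * real_of_int (fst Q)" using ab that by (simp add: mult_left_mono)
    with ab have "b * real_of_int (snd P) < b * real_of_int (snd Q)" by linarith
    then have s: "snd P < snd Q" using ab(2) by (simp add: mult_less_cancel_left)
    then have "d * real_of_int (snd P) \<le> d * real_of_int (snd Q)" using cd by (simp add: mult_left_mono)
    with cd have "c * real_of_int (fst P) < c * real_of_int (fst Q)" by linarith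
    then have "fst P < fst Q" using cd(1) by (simp add: mult_less_cancel_left)
    with s show ?thesis by simp
  qed
  define slope where "slope P Q = (real_of_int (snd Q) - snd P) / (real_of_int (fst Q) - fst P)"
    for P Q :: "int \<times> int"
  have slope_less: "slope P Q < slope Q R"
    if "P \<in> S" "Q \<in> S" "R \<in> S" "fst P < fst Q" "fst Q < fst R" for P Q R
  proof -
    have "P \<noteq> Q" "R \<noteq> Q" using that by auto
    with ext[OF that(2)] that obtain a b :: real where ab: "a \<ge> 0" "b \<ge> 0"
      "a * real_of_int (fst P) - b * real_of_int (snd P) < a * real_of_int (fst Q) - b * real_of_int (snd Q)"
      "a * real_of_int (fst R) - b * real_of_int (snd R) < a * real_of_int (fst Q) - b * real_of_int (snd Q)" by (metis Diff_iff singletonD)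
    have b: "b > 0"
    proof (rule ccontr)
      assume "\<not> b > 0"
      with ab have "b = 0" by simp
      moreover have "a * real_of_int (fst Q) \<le> a * real_of_int (fst R)" using ab that by (intro mult_left_mono) auto
      ultimately show False using ab by simp
    qed
    \<comment> \<open>The level line through \<open>Q\<close> of its supporting functional has slope
      \<open>a / b\<close> and leaves \<open>P\<close> and \<open>R\<close> strictly above it, so it
      separates the two slopes.\<close>
    have "slope P Q < a / b"
      using that ab b by (simp add: slope_def divide_simps algebra_simps)
    also have "\<dots> < slope Q R"
      using that ab b by (simp add: slope_def divide_simps algebra_simps)
    finally show ?thesis .
  qed
  have inj_fst: "inj_on fst S" using mono by (force intro!: inj_onI)
  define xs where "xs = sorted_list_of_set (fst ` S)"
  define r where "r = card S - 1"
  have len: "length xs = Suc r"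
    using fin nonempty inj_fst by (simp add: xs_def r_def card_image card_gt_0_iff)
  have set: "set xs = fst ` S" using fin by (simp add: xs_def)
  have sorted: "sorted_wrt (<) xs" by (simp add: xs_def)
  \<comment> \<open>The points in order of first coordinate; \<open>inj_fst\<close> makes each point
    recoverable from it.\<close>
  define pt where "pt i = inv_into S fst (xs ! i)" for i
  have pt: "pt i \<in> S" "fst (pt i) = xs ! i" if "i \<le> r" for i
    using that len set nth_mem[of i xs] by (auto simp: pt_def inv_into_into f_inv_into_f)
  have less: "fst (pt i) < fst (pt j)" if "i < j" "j \<le> r" for i j
    using that sorted len by (simp add: pt sorted_wrt_iff_nth_less)
  have "int r ^ 3 \<le> 32 * W * H"
  proof (rule distinct_positive_steps_area[of r "fst \<circ> pt" "snd \<circ> pt"])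
    show "(fst \<circ> pt) i < (fst \<circ> pt) (Suc i)" if "i < r" for i
      using less[of i "Suc i"] that by simp
    show "(snd \<circ> pt) i < (snd \<circ> pt) (Suc i)" if "i < r" for i
    proof -
      have "fst (pt i) < fst (pt (Suc i))" using less that by simp
      moreover from this have "pt i \<noteq> pt (Suc i)" by auto
      ultimately show ?thesis using mono[of "pt i" "pt (Suc i)"] pt that by simp
    qed
    show "inj_on (\<lambda>i. ((fst \<circ> pt) (Suc i) - (fst \<circ> pt) i, (snd \<circ> pt) (Suc i) - (snd \<circ> pt) i)) {..<r}"
    proof (rule linorder_inj_onI')
      fix i j assume ij: "i \<in> {..<r}" "j \<in> {..<r}" "i < j"
      have step: "slope (pt k) (pt (Suc k)) < slope (pt (Suc k)) (pt (Suc (Suc k)))" if "Suc k < r" for k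
        using slope_less pt less that by simp
      \<comment> \<open>The slope of a step is determined by its vector, so strictly increasing
        slopes exclude repeated vectors.\<close>
      have "slope (pt i) (pt (Suc i)) < slope (pt j) (pt (Suc j))"
        using \<open>i < j\<close> \<open>j \<in> {..<r}\<close>
      proof (induction j)
        case (Suc j)
        then show ?case using step[of j] by (cases "i = j") force+
      qed simp
      then
      show "((fst \<circ> pt) (Suc i) - (fst \<circ> pt) i, (snd \<circ> pt) (Suc i) - (snd \<circ> pt) i) \<noteq>
         ((fst \<circ> pt) (Suc j) - (fst \<circ> pt) j, (snd \<circ> pt) (Suc j) - (snd \<circ> pt) j)"
        by (auto simp: slope_def simp flip: of_int_diff)
    qed
  qed (use W[of "pt r" "pt 0"] H[of "pt r" "pt 0"] pt in auto)
  then show ?thesis by (simp add: r_def)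
qed

text \<open>Sorting the points by the signs of a supporting functional gives four classes. By
  pigeonhole one holds a quarter of the points, and reflecting in the axes moves it into the
  quadrant case.\<close>

lemma strictly_extreme_points_area:
  fixes S :: "(int \<times> int) set" and W H :: int
  assumes fin: "finite S" and nonempty: "S \<noteq> {}"
    and ext: "\<And>P. P \<in> S \<Longrightarrow> \<exists>g. \<forall>Q\<in>S - {P}. g \<bullet> to_plane Q < g \<bullet> to_plane P"
    and W: "\<And>P Q. P \<in> S \<Longrightarrow> Q \<in> S \<Longrightarrow> fst P - fst Q \<le> W"
    and H: "\<And>P Q. P \<in> S \<Longrightarrow> Q \<in> S \<Longrightarrow> snd P - snd Q \<le> H"
  shows "int ((card S - 1) div 4) ^ 3 \<le> 32 * W * H"
proof -
  let ?signs = "{1, -1} \<times> {1, -1} :: (int \<times> int) set"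
  \<comment> \<open>Weak inequalities make the four classes cover \<open>S\<close>; they may
    overlap, which does no harm to the count.\<close>
  define T where "T = (\<lambda>(s, t). {P \<in> S. \<exists>g. real_of_int s * fst g \<ge> 0 \<and> real_of_int t * snd g \<le> 0 \<and>
    (\<forall>Q\<in>S - {P}. g \<bullet> to_plane Q < g \<bullet> to_plane P)})"
  have "S \<subseteq> (\<Union>\<sigma>\<in>?signs. T \<sigma>)"
  proof
    fix P assume P: "P \<in> S"
    then obtain g where "\<forall>Q\<in>S - {P}. g \<bullet> to_plane Q < g \<bullet> to_plane P" using ext by blast
    then have "P \<in> T (if fst g \<ge> 0 then 1 else -1, if snd g \<le> 0 then 1 else -1)"
      using P by (auto simp: T_def simp del: split_paired_Ex intro!: exI[of _ g])
    then show "P \<in> (\<Union>\<sigma>\<in>?signs. T \<sigma>)" by (intro UN_I) auto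
  qed
  moreover have TS: "T \<sigma> \<subseteq> S" for \<sigma> by (auto simp: T_def split: prod.splits)
  ultimately have "card S \<le> card (\<Union>\<sigma>\<in>?signs. T \<sigma>)"
    by (intro card_mono finite_UN_I finite_subset[OF TS fin]) simp_all
  also have "\<dots> \<le> (\<Sum>\<sigma>\<in>?signs. card (T \<sigma>))" by (rule card_UN_le) simp
  finally have cardS: "card S \<le> (\<Sum>\<sigma>\<in>?signs. card (T \<sigma>))" .
  have "\<exists>\<sigma>\<in>?signs. card S \<le> 4 * card (T \<sigma>)"
  proof (rule ccontr)
    assume "\<not> ?thesis"
    then have "(\<Sum>\<sigma>\<in>?signs. 4 * card (T \<sigma>)) < (\<Sum>\<sigma>\<in>?signs. card S)"
      by (intro sum_strict_mono) (auto simp: not_le)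
    with cardS show False by (simp flip: sum_distrib_left)
  qed
  then obtain s t where st: "s \<in> {1, -1}" "t \<in> {1, -1}" "card S \<le> 4 * card (T (s, t))" by blast
  define refl where "refl = (\<lambda>P :: int \<times> int. (s * fst P, t * snd P))"
  have inj: "inj refl" using st by (auto simp: refl_def inj_def prod_eq_iff)
  have "card S > 0" using fin nonempty by (simp add: card_gt_0_iff)
  then have "card (T (s, t)) > 0" using st by linarith
  then have "T (s, t) \<noteq> {}" by auto
  have "int (card (refl ` T (s, t)) - 1) ^ 3 \<le> 32 * W * H"
  proof (rule quadrant_extreme_points_area)
    show "finite (refl ` T (s, t))" by (rule finite_imageI[OF finite_subset[OF TS fin]])
    show "refl ` T (s, t) \<noteq> {}" using \<open>T (s, t) \<noteq> {}\<close> by simp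
    fix P' assume "P' \<in> refl ` T (s, t)"
    then obtain P g where P: "P' = refl P" "P \<in> S" and g: "real_of_int s * fst g \<ge> 0" "real_of_int t * snd g \<le> 0"
      "\<And>Q. Q \<in> S - {P} \<Longrightarrow> g \<bullet> to_plane Q < g \<bullet> to_plane P"
      by (auto simp: T_def)
    \<comment> \<open>As \<open>s\<close> and \<open>t\<close> square to 1, the reflected functional
      takes on \<open>refl Q\<close> the value of \<open>g\<close> on \<open>Q\<close>.\<close>
    have "(real_of_int s * fst g) * real_of_int (fst Q') - (- real_of_int t * snd g) * real_of_int (snd Q')
        < (real_of_int s * fst g) * real_of_int (fst P') - (- real_of_int t * snd g) * real_of_int (snd P')"
      if Q': "Q' \<in> refl ` T (s, t) - {P'}" for Q'
    proof -
      from Q' TS P obtain Q where "Q' = refl Q" "Q \<in> S - {P}" by blast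
      with g(3)[of Q] P st show ?thesis
        by (auto simp: refl_def to_plane_def inner_prod_def)
    qed
    then show "\<exists>a b::real. a \<ge> 0 \<and> b \<ge> 0 \<and> (\<forall>Q'\<in>refl ` T (s, t) - {P'}.
        a * real_of_int (fst Q') - b * real_of_int (snd Q') < a * real_of_int (fst P') - b * real_of_int (snd P'))"
      using g by (intro exI[of _ "real_of_int s * fst g"] exI[of _ "- real_of_int t * snd g"]) auto
  next
    fix P' Q' assume "P' \<in> refl ` T (s, t)" "Q' \<in> refl ` T (s, t)"
    then obtain P Q where "P' = refl P" "Q' = refl Q" "P \<in> S" "Q \<in> S" using TS by blast
    then show "fst P' - fst Q' \<le> W" "snd P' - snd Q' \<le> H"
      using W[of P Q] W[of Q P] H[of P Q] H[of Q P] st by (auto simp: refl_def)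
  qed
  also have "card (refl ` T (s, t)) = card (T (s, t))"
    by (rule card_image) (use inj in \<open>auto intro: inj_on_subset\<close>)
  finally have "int (card (T (s, t)) - 1) ^ 3 \<le> 32 * W * H" .
  \<comment> \<open>From \<open>card S\<close> \<le> \<open>4 * c\<close> with c \<ge> 1 one gets
    \<open>(card S - 1) div 4\<close> \<le> \<open>(4 * c - 1) div 4 = c - 1\<close>.\<close>
  moreover have "int ((card S - 1) div 4) ^ 3 \<le> int (card (T (s, t)) - 1) ^ 3"
    using st by (intro power_mono) auto
  ultimately show ?thesis by linarith
qed

subsection \<open>Corners of convex drawings\<close>

text \<open>Coordinates in which the angle spanned by \<open>a\<close> and \<open>b\<close> becomes
  the first quadrant: \<open>u\<close> and \<open>v\<close> are the rows of the inverse of the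
  matrix with columns \<open>a\<close> and \<open>b\<close>, whose determinant is
  \<open>D\<close>.\<close>

lemma dual_basis_exists:
  fixes a b :: "real \<times> real"
  assumes "\<not> collinear {0, a, b}"
  obtains u v where "u \<bullet> a = 1" "u \<bullet> b = 0" "v \<bullet> a = 0" "v \<bullet> b = 1"
    "\<And>x. u \<bullet> x = 0 \<Longrightarrow> v \<bullet> x = 0 \<Longrightarrow> x = 0"
proof -
  define D where "D = fst a * snd b - snd a * fst b"
  have D: "D \<noteq> 0"
  proof
    assume D0: "D = 0"
    have "a \<noteq> 0" using assms by (auto simp: collinear_lemma)
    then have "b = (if fst a \<noteq> 0 then fst b / fst a else snd b / snd a) *\<^sub>R a"
      using D0 by (auto simp: D_def prod_eq_iff field_simps)
    then have "\<exists>c. b = c *\<^sub>R a" by blast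
    then show False using assms by (simp add: collinear_lemma)
  qed
  define u v where "u = (snd b / D, - fst b / D)" and "v = (- snd a / D, fst a / D)"
  show ?thesis
  proof
    show "u \<bullet> a = 1" "u \<bullet> b = 0" "v \<bullet> a = 0" "v \<bullet> b = 1"
      using D by (auto simp: u_def v_def inner_prod_def simp flip: add_divide_distrib diff_divide_distrib)
        (auto simp: D_def algebra_simps)
    fix x assume "u \<bullet> x = 0" "v \<bullet> x = 0"
    then have h: "snd b * fst x = fst b * snd x" "fst a * snd x = snd a * fst x"
      using D by (auto simp: u_def v_def inner_prod_def field_simps)
    have "D * fst x = fst a * (snd b * fst x) - fst b * (snd a * fst x)"
      by (simp add: D_def algebra_simps)
    also have "\<dots> = 0" unfolding h(1) by (simp flip: h(2))
    finally have "fst x = 0" using D by simp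
    moreover have "D * snd x = snd b * (fst a * snd x) - snd a * (fst b * snd x)"
      by (simp add: D_def algebra_simps)
    then have "D * snd x = 0" using \<open>fst x = 0\<close> h by simp
    ultimately show "x = 0" using D by (simp add: prod_eq_iff)
  qed
qed

text \<open>Locally at \<open>w\<close> the set \<open>D\<close> is an angle of less than \<open>\<pi>\<close>. The reflex side of that angle lies in a
  single face, which contains two points with midpoint \<open>w\<close> and so cannot be convex. Hence it is
  the outer face, whose complement is convex and thus confined to the angle.\<close>
lemma degree_two_corner_supported:
  fixes D :: "(real \<times> real) set"
  assumes inner: "\<And>F. F \<in> components (- D) \<Longrightarrow> bounded F \<Longrightarrow> convex F"
    and outer: "\<And>F. F \<in> components (- D) \<Longrightarrow> \<not> bounded F \<Longrightarrow> convex (- F)"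
    and C: "closed C" "w \<notin> C"
    and D: "D = closed_segment w a \<union> closed_segment w b \<union> C"
    and angle: "\<not> collinear {0, a - w, b - w}"
  obtains g where "\<And>q. q \<in> D \<Longrightarrow> q \<noteq> w \<Longrightarrow> g \<bullet> q < g \<bullet> w"
proof -
  obtain u v where uv: "u \<bullet> (a - w) = 1" "u \<bullet> (b - w) = 0" "v \<bullet> (a - w) = 0" "v \<bullet> (b - w) = 1"
    and dual: "\<And>x. u \<bullet> x = 0 \<Longrightarrow> v \<bullet> x = 0 \<Longrightarrow> x = 0"
    using dual_basis_exists[OF angle] by metis
  obtain e where e: "e > 0" "ball w e \<inter> C = {}"
    using C by (metis Compl_iff disjoint_eq_subset_Compl open_Compl openE)
  \<comment> \<open>Two open half-discs at \<open>w\<close>, in a disc avoiding \<open>C\<close>.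
    Their union is the reflex side of the angle: where the \<open>u\<close> or the \<open>v\<close>
    coordinate relative to \<open>w\<close> is negative.\<close>
  define Ru Rv where "Ru = ball w e \<inter> {x. u \<bullet> x < u \<bullet> w}" and "Rv = ball w e \<inter> {x. v \<bullet> x < v \<bullet> w}"
  have small: "\<exists>t. 0 < t \<and> t < 1 \<and> w + t *\<^sub>R d \<in> ball w e" for d
  proof -
    define t where "t = min (1/2) (e / (2 * (norm d + 1)))"
    have "t * norm d \<le> e / (2 * (norm d + 1)) * norm d"
      by (intro mult_right_mono) (auto simp: t_def)
    also have "\<dots> < e" using e by (simp add: divide_simps) (smt (verit) mult_nonneg_nonneg norm_ge_zero)
    finally have "t * norm d < e" .
    moreover have "t > 0" "t < 1" using e by (auto simp: t_def add_nonneg_pos)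
    ultimately show ?thesis by (intro exI[of _ t]) (auto simp: dist_norm)
  qed
  have seg: "0 \<le> u \<bullet> x - u \<bullet> w \<and> 0 \<le> v \<bullet> x - v \<bullet> w" if x: "x \<in> closed_segment w a \<union> closed_segment w b" for x
  proof -
    obtain t c where t: "0 \<le> t" "x = w + t *\<^sub>R (c - w)" "c = a \<or> c = b"
    proof -
      from x obtain c where c: "c = a \<or> c = b" "x \<in> closed_segment w c" by blast
      then obtain t where "0 \<le> t" "x = (1 - t) *\<^sub>R w + t *\<^sub>R c" by (auto simp: in_segment)
      with c show ?thesis by (intro that[of t c]) (simp_all add: algebra_simps)
    qed
    then have "u \<bullet> x - u \<bullet> w = t * (u \<bullet> (c - w))" "v \<bullet> x - v \<bullet> w = t * (v \<bullet> (c - w))"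
      by (simp_all add: inner_add_right)
    with t uv show ?thesis by auto
  qed
  have disj: "(Ru \<union> Rv) \<inter> D = {}"
    using seg e(2) by (fastforce simp: Ru_def Rv_def D)
  \<comment> \<open>This direction has both dual coordinates equal to -1, so the two half-discs
    overlap.\<close>
  obtain t where t: "0 < t" "w + t *\<^sub>R (- (a - w) - (b - w)) \<in> ball w e" using small by blast
  have "w + t *\<^sub>R (- (a - w) - (b - w)) \<in> Ru \<inter> Rv"
    using t uv by (simp add: Ru_def Rv_def inner_add_right inner_diff_right mult_less_0_iff)
  moreover have "connected Ru" "connected Rv"
    by (auto simp: Ru_def Rv_def intro!: convex_connected convex_Int convex_halfspace_lt)
  ultimately have conn: "connected (Ru \<union> Rv)" by (intro connected_Un) auto
  \<comment> \<open>The direction \<open>b - a\<close> has dual coordinates -1 and 1, so the two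
    opposite points at \<open>w\<close> fall into \<open>Ru\<close> and \<open>Rv\<close>
    respectively; their midpoint is \<open>w\<close>.\<close>
  obtain s where s: "0 < s" "w + s *\<^sub>R (b - a) \<in> ball w e" using small by blast
  have s': "w - s *\<^sub>R (b - a) \<in> ball w e" using s by (simp add: dist_norm)
  have pR: "w + s *\<^sub>R (b - a) \<in> Ru"
    using s uv by (simp add: Ru_def inner_add_right inner_diff_right mult_less_0_iff)
  have qR: "w - s *\<^sub>R (b - a) \<in> Rv"
    using s s' uv by (simp add: Rv_def inner_add_right inner_diff_right mult_less_0_iff)
  obtain F where F: "F \<in> components (- D)" "Ru \<union> Rv \<subseteq> F"
    using exists_component_superset[of "Ru \<union> Rv" "- D"] disj conn pR by blast
  have FD: "F \<inter> D = {}" using in_components_subset[OF F(1)] by blast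
  have "\<not> convex F"
  proof
    assume "convex F"
    moreover have "w + s *\<^sub>R (b - a) \<in> F" "w - s *\<^sub>R (b - a) \<in> F" using pR qR F by auto
    ultimately have "(1/2) *\<^sub>R (w + s *\<^sub>R (b - a)) + (1/2) *\<^sub>R (w - s *\<^sub>R (b - a)) \<in> F"
      by (intro convexD) auto
    then have "w \<in> F" by (simp add: algebra_simps flip: scaleR_add_left)
    then show False using FD D by auto
  qed
  then have K: "convex (- F)" using inner outer F(1) by blast
  \<comment> \<open>A point \<open>q\<close> of \<open>D\<close> outside the angle would put points
    of the segment from \<open>w\<close> to \<open>q\<close> near \<open>w\<close> into
    \<open>F\<close>, although both ends lie in the convex set \<open>- F\<close>.\<close>
  have cone: "0 \<le> u \<bullet> (q - w) \<and> 0 \<le> v \<bullet> (q - w)" if "q \<in> D" for q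
  proof (rule ccontr)
    assume neg: "\<not> ?thesis"
    obtain r where r: "0 < r" "r < 1" "w + r *\<^sub>R (q - w) \<in> ball w e" using small by blast
    have "r * (u \<bullet> (q - w)) < 0 \<or> r * (v \<bullet> (q - w)) < 0" using neg r by (auto simp: mult_less_0_iff)
    then have "w + r *\<^sub>R (q - w) \<in> F"
      using r F(2) by (auto simp: Ru_def Rv_def inner_add_right)
    moreover have "(1 - r) *\<^sub>R w + r *\<^sub>R q \<in> - F"
      using K that FD D r by (intro convexD) auto
    ultimately show False by (simp add: algebra_simps)
  qed
  show ?thesis
  proof
    fix q assume q: "q \<in> D" "q \<noteq> w"
    then have "u \<bullet> (q - w) \<noteq> 0 \<or> v \<bullet> (q - w) \<noteq> 0" using dual[of "q - w"] by auto
    with cone[OF q(1)] have "0 < u \<bullet> (q - w) + v \<bullet> (q - w)" by linarith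
    then show "- (u + v) \<bullet> q < - (u + v) \<bullet> w"
      by (simp add: inner_add_left inner_diff_left inner_diff_right)
  qed
qed

lemma seg_of_doubleton: "seg_of p {u, w} = closed_segment (to_plane (p u)) (to_plane (p w))"
  by (auto simp: seg_of_def closed_segment_commute)

lemma inj_to_plane: "inj to_plane"
  by (auto simp: to_plane_def inj_def prod_eq_iff)

text \<open>Of three collinear points one lies on the segment joining the other two, and here that
  segment is an edge not incident to it.\<close>

lemma triangle_not_collinear:
  assumes drawing: "straight_planar_grid_drawing V E p"
    and V: "a \<in> V" "b \<in> V" "w \<in> V" and distinct: "a \<noteq> b" "a \<noteq> w" "b \<noteq> w"
    and E: "{w, a} \<in> E" "{w, b} \<in> E" "{a, b} \<in> E"
  shows "\<not> collinear {to_plane (p w), to_plane (p a), to_plane (p b)}"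
proof
  assume "collinear {to_plane (p w), to_plane (p a), to_plane (p b)}"
  then have "to_plane (p w) \<in> seg_of p {a, b} \<or> to_plane (p a) \<in> seg_of p {w, b} \<or> to_plane (p b) \<in> seg_of p {w, a}"
    by (auto simp: collinear_between_cases between_mem_segment seg_of_doubleton closed_segment_commute)
  moreover have "v \<in> e" if "e \<in> E" "v \<in> V" "to_plane (p v) \<in> seg_of p e" for v e
    using drawing that by (simp add: straight_planar_grid_drawing_def)
  ultimately have "w \<in> {a, b} \<or> a \<in> {w, b} \<or> b \<in> {w, a}"
    using V E by blast
  with distinct show False by auto
qed

text \<open>Without \<open>w\<close> and its two edges the drawing is a closed set \<open>C\<close>
  missing \<open>w\<close>, and the edge \<open>{a, b}\<close> prevents a straight angle at
  \<open>w\<close>; so the corner lemma applies.\<close>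

lemma ear_tip_supported:
  assumes drawing: "convex_grid_drawing V E p" and graph: "simple_graph V E"
    and ear: "{w, a} \<in> E" "{w, b} \<in> E" "{a, b} \<in> E" "a \<noteq> b"
    and degree: "\<And>e. e \<in> E \<Longrightarrow> w \<in> e \<Longrightarrow> e = {w, a} \<or> e = {w, b}"
  obtains g where "\<And>q. q \<in> V \<Longrightarrow> q \<noteq> w \<Longrightarrow> g \<bullet> to_plane (p q) < g \<bullet> to_plane (p w)"
proof -
  have straight: "straight_planar_grid_drawing V E p"
    using drawing by (simp add: convex_grid_drawing_def)
  have inj: "inj_on (to_plane \<circ> p) V"
    using straight inj_to_plane
    by (auto simp: straight_planar_grid_drawing_def intro!: comp_inj_on intro: inj_on_subset)
  have fin: "finite V" "finite E"
    using graph by (auto simp: simple_graph_def intro: finite_subset[of E "Pow V"])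
  have V: "w \<in> V" "a \<in> V" "b \<in> V" and distinct: "a \<noteq> w" "b \<noteq> w"
    using graph ear by (auto simp: simple_graph_def card_2_iff doubleton_eq_iff)
  define E' where "E' = E - {{w, a}, {w, b}}"
  define C where "C = (to_plane \<circ> p) ` (V - {w}) \<union> (\<Union>e\<in>E'. seg_of p e)"
  have "closed (seg_of p e)" if "e \<in> E'" for e
    using that graph by (auto simp: E'_def simple_graph_def card_2_iff seg_of_doubleton)
  then have closed: "closed C"
    unfolding C_def using fin by (intro closed_Un closed_UN finite_imp_closed) (auto simp: E'_def)
  have notin: "to_plane (p w) \<notin> C"
  proof
    assume "to_plane (p w) \<in> C"
    then consider v where "v \<in> V" "v \<noteq> w" "to_plane (p w) = to_plane (p v)"
      | e where "e \<in> E'" "to_plane (p w) \<in> seg_of p e" by (auto simp: C_def)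
    then show False
    proof cases
      case 1
      then show ?thesis using inj V by (auto simp: inj_on_def)
    next
      case 2
      then have "w \<in> e" using straight V by (auto simp: straight_planar_grid_drawing_def E'_def)
      then show ?thesis using degree 2 by (auto simp: E'_def)
    qed
  qed
  have D: "grid_drawing_set V E p =
      closed_segment (to_plane (p w)) (to_plane (p a)) \<union> closed_segment (to_plane (p w)) (to_plane (p b)) \<union> C"
  proof -
    have "(\<Union>e\<in>E. seg_of p e) = seg_of p {w, a} \<union> seg_of p {w, b} \<union> (\<Union>e\<in>E'. seg_of p e)"
      using ear by (auto simp: E'_def)
    moreover have "(to_plane \<circ> p) ` V = insert (to_plane (p w)) ((to_plane \<circ> p) ` (V - {w}))"
      using V by auto
    ultimately show ?thesis
      by (auto simp: grid_drawing_set_def C_def seg_of_doubleton)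
  qed
  have angle: "\<not> collinear {0, to_plane (p a) - to_plane (p w), to_plane (p b) - to_plane (p w)}"
    using triangle_not_collinear[OF straight V(2,3,1) ear(4) distinct ear(1-3)]
    by (subst (asm) insert_commute) (simp add: collinear_3)
  have faces: "bounded F \<Longrightarrow> convex F" "\<not> bounded F \<Longrightarrow> convex (- F)"
    if "F \<in> components (- grid_drawing_set V E p)" for F
    using drawing that by (auto simp: convex_grid_drawing_def)
  obtain g where g:
    "\<And>q. q \<in> grid_drawing_set V E p \<Longrightarrow> q \<noteq> to_plane (p w) \<Longrightarrow> g \<bullet> q < g \<bullet> to_plane (p w)"
    using degree_two_corner_supported[OF faces closed notin D angle] by blast
  show ?thesis
  proof
    fix q assume "q \<in> V" "q \<noteq> w"
    then show "g \<bullet> to_plane (p q) < g \<bullet> to_plane (p w)"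
      using g[of "to_plane (p q)"] inj V by (auto simp: grid_drawing_set_def inj_on_def)
  qed
qed

subsection \<open>Outerplanar drawings on a parabola\<close>

text \<open>The region is not convex, but it is a continuous image of a half-plane: a point is given
  by its abscissa and its depth below the parabola.\<close>

lemma connected_below_parabola: "connected {q :: real \<times> real. snd q < (fst q)\<^sup>2}"
proof -
  have "connected ((\<lambda>q::real \<times> real. (fst q, (fst q)\<^sup>2 - snd q)) ` (UNIV \<times> {0<..}))"
    by (intro connected_continuous_image continuous_intros convex_connected convex_Times) auto
  also have "(\<lambda>q::real \<times> real. (fst q, (fst q)\<^sup>2 - snd q)) ` (UNIV \<times> {0<..}) = {q. snd q < (fst q)\<^sup>2}"
  proof (intro subset_antisym subsetI)
    fix q :: "real \<times> real" assume "q \<in> {q. snd q < (fst q)\<^sup>2}"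
    then show "q \<in> (\<lambda>q. (fst q, (fst q)\<^sup>2 - snd q)) ` (UNIV \<times> {0<..})"
      \<comment> \<open>The map is an involution, so it supplies its own preimages.\<close>
      by (intro image_eqI[of _ _ "(fst q, (fst q)\<^sup>2 - snd q)"]) auto
  qed auto
  finally show ?thesis .
qed

text \<open>Writing the chord's height above the parabola as a product turns the comparison of two
  chords at the same abscissa into a comparison of products.\<close>

lemma parabola_chord:
  fixes a b :: real
  assumes "a < b" "q \<in> closed_segment (a, a\<^sup>2) (b, b\<^sup>2)"
  shows "a \<le> fst q" "fst q \<le> b" "snd q = (fst q)\<^sup>2 + (fst q - a) * (b - fst q)"
proof -
  from assms(2) obtain u where u: "0 \<le> u" "u \<le> 1" "fst q = (1 - u) * a + u * b" "snd q = (1 - u) * a\<^sup>2 + u * b\<^sup>2"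
    by (auto simp: in_segment)
  have eq: "fst q - a = u * (b - a)" "b - fst q = (1 - u) * (b - a)" by (simp_all add: u algebra_simps)
  have "0 \<le> fst q - a" "0 \<le> b - fst q" unfolding eq using u assms by simp_all
  then show "a \<le> fst q" "fst q \<le> b" by simp_all
  show "snd q = (fst q)\<^sup>2 + (fst q - a) * (b - fst q)"
    unfolding u by (simp add: power2_eq_square algebra_simps)
qed

text \<open>A vertical line meets two nested chords of a convex curve at different heights, unless it
  passes through a common endpoint.\<close>
lemma nested_products_eq:
  fixes x a b c d :: real
  assumes "a \<le> c" "d \<le> b" "c \<le> x" "x \<le> d" "(x - a) * (b - x) = (x - c) * (d - x)" "\<not> (a = c \<and> b = d)"
  shows "x = a \<and> x = c \<or> x = b \<and> x = d"
proof -
  \<comment> \<open>Enlarging the interval one end at a time gives a chain of inequalities; equality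
    of its ends forces equality in both links.\<close>
  have "(x - c) * (d - x) \<le> (x - a) * (d - x)"
    using assms(1,4) by (intro mult_right_mono) simp_all
  moreover have "(x - a) * (d - x) \<le> (x - a) * (b - x)"
    using assms(1-3) by (intro mult_left_mono) simp_all
  moreover note assms(5)
  ultimately have "(x - c) * (d - x) = (x - a) * (d - x)" "(x - a) * (d - x) = (x - a) * (b - x)"
    by linarith+
  then have "(c = a \<or> x = d) \<and> (x = a \<or> d = b)" by auto
  with assms(1-4,6) show ?thesis by auto
qed

text \<open>With vertex \<open>i\<close> at (i, i^2) and edges as chords, noncrossing intervals give
  chords meeting only in common endpoints. Everything lies on or above the parabola, so the region
  below it is in one unbounded face, whose closure contains every vertex.\<close>

lemma noncrossing_graph_outerplanar:
  fixes adj :: "nat \<Rightarrow> nat \<Rightarrow> bool"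
  assumes adj: "\<And>a b. adj a b \<Longrightarrow> a < b \<and> b < n"
    and noncrossing: "\<And>a b c d. adj a b \<Longrightarrow> adj c d \<Longrightarrow>
      b \<le> c \<or> d \<le> a \<or> a \<le> c \<and> d \<le> b \<or> c \<le> a \<and> b \<le> d"
  shows "outerplanar {..<n} {{a, b} |a b. adj a b}"
proof -
  define pos where "pos i = (real i, (real i)\<^sup>2)" for i
  \<comment> \<open>An edge is an unordered set, so \<open>Min\<close> and \<open>Max\<close> fix
    its orientation from left to right.\<close>
  define arc_of where "arc_of e = linepath (pos (Min e)) (pos (Max e))" for e
  define E where "E = {{a, b} |a b. adj a b}"
  define D where "D = drawing_set {..<n} E pos arc_of"
  have inj: "inj pos" by (auto simp: pos_def inj_def)
  have arc_of: "arc_of {a, b} = linepath (pos a) (pos b)" if "adj a b" for a b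
    using adj[OF that] by (simp add: arc_of_def min_def max_def)
  have chord: "real a \<le> fst q \<and> fst q \<le> real b \<and> snd q = (fst q)\<^sup>2 + (fst q - real a) * (real b - fst q)"
    if "adj a b" "q \<in> path_image (arc_of {a, b})" for a b q
    using parabola_chord[of "real a" "real b" q] that adj[OF that(1)] by (simp add: arc_of pos_def)
  have on_parabola: "q = pos i" if "fst q = real i" "snd q = (fst q)\<^sup>2" for q i
    using that by (simp add: pos_def prod_eq_iff)
  have meet: "q \<in> pos ` ({a, b} \<inter> {c, d})"
    if "adj a b" "adj c d" "{a, b} \<noteq> {c, d}" "q \<in> path_image (arc_of {a, b})" "q \<in> path_image (arc_of {c, d})"
    for a b c d q
  proof -
    note ab = chord[OF that(1,4)] and cd = chord[OF that(2,5)]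
    have eq: "(fst q - real a) * (real b - fst q) = (fst q - real c) * (real d - fst q)"
      using ab cd by simp
    have ne: "\<not> (a = c \<and> b = d)" using that by auto
    have "\<exists>i \<in> {a, b} \<inter> {c, d}. fst q = real i"
      using noncrossing[OF that(1,2)]
    proof (elim disjE conjE)
      assume "b \<le> c"
      then have "fst q = real b" "b = c" using ab cd by auto
      then show ?thesis by auto
    next
      assume "d \<le> a"
      then have "fst q = real a" "d = a" using ab cd by auto
      then show ?thesis by auto
    next
      assume "a \<le> c" "d \<le> b"
      then show ?thesis
        using nested_products_eq[of a c d b "fst q"] ab cd eq ne by fastforce
    next
      assume "c \<le> a" "b \<le> d"
      then show ?thesis
        using nested_products_eq[of c a b d "fst q"] ab cd eq ne by fastforce
    qed
    then obtain i where i: "i \<in> {a, b} \<inter> {c, d}" "fst q = real i" by blast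
    then have "snd q = (fst q)\<^sup>2" using ab cd by auto
    with i on_parabola show ?thesis by blast
  qed
  have planar: "planar_drawing {..<n} E pos arc_of"
    unfolding planar_drawing_def
  proof (intro conjI ballI impI)
    show "inj_on pos {..<n}" using inj by (rule inj_on_subset) simp
    fix e assume "e \<in> E"
    then obtain a b where e: "e = {a, b}" "adj a b" by (auto simp: E_def)
    show "arc (arc_of e)" using adj[OF e(2)] inj by (auto simp: e arc_of inj_eq)
    show "{pathstart (arc_of e), pathfinish (arc_of e)} = pos ` e" by (simp add: e arc_of)
    show "v \<in> e" if "pos v \<in> path_image (arc_of e)" for v
      using chord[OF e(2), of "pos v"] that by (auto simp: e pos_def)
    show "path_image (arc_of e) \<inter> path_image (arc_of e') \<subseteq> pos ` (e \<inter> e')" if "e' \<in> E" "e \<noteq> e'" for e'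
    proof -
      from that obtain c d where e': "e' = {c, d}" "adj c d" by (auto simp: E_def)
      with e that have "{a, b} \<noteq> {c, d}" by simp
      from meet[OF e(2) e'(2) this] show ?thesis unfolding e e' by blast
    qed
  qed
  have "(fst q)\<^sup>2 \<le> snd q" if "q \<in> D" for q
  proof -
    from that consider v where "q = pos v" | a b where "adj a b" "q \<in> path_image (arc_of {a, b})"
      by (auto simp: D_def drawing_set_def E_def)
    then show ?thesis
    proof cases
      case 1
      then show ?thesis by (simp add: pos_def)
    next
      case 2
      with chord[OF 2] show ?thesis by simp
    qed
  qed
  then have below: "{q. snd q < (fst q)\<^sup>2} \<subseteq> - D" by force
  moreover have "(0, -1) \<in> {q::real\<times>real. snd q < (fst q)\<^sup>2}" by simp
  ultimately obtain Fo where Fo: "Fo \<in> components (- D)" "{q. snd q < (fst q)\<^sup>2} \<subseteq> Fo"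
    using exists_component_superset[of _ "- D"] connected_below_parabola by blast
  have "\<not> bounded Fo"
  proof
    assume "bounded Fo"
    then obtain B where B: "\<And>q. q \<in> Fo \<Longrightarrow> norm q \<le> B" by (auto simp: bounded_iff)
    have "norm (0::real, - (\<bar>B\<bar> + 1)) \<le> B" using Fo(2) by (intro B) auto
    then show False by (simp add: norm_Pair)
  qed
  moreover have "pos v \<in> closure Fo" for v
    unfolding closure_approachable
  proof (intro allI impI)
    fix e :: real assume e: "e > 0"
    have "dist (real v, (real v)\<^sup>2 - e / 2) (pos v) < e"
      using e by (simp add: pos_def dist_Pair_Pair dist_norm)
    moreover have "(real v, (real v)\<^sup>2 - e / 2) \<in> Fo" using e Fo(2) by auto
    ultimately show "\<exists>y\<in>Fo. dist y (pos v) < e" by blast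
  qed
  ultimately show ?thesis
    unfolding outerplanar_def E_def[symmetric] using planar Fo(1) unfolding D_def by blast
qed

subsection \<open>The graph\<close>

text \<open>For m \<ge> 2 the even vertices form the cycle 0, 2, ..., 2m, and the odd vertex 2j+1 is
  the tip of the ear on the side {2j, 2j+2}. The side {0, 2m} carries no ear. Edges are ordered
  pairs so that they can be treated as intervals.\<close>

definition sun_adj :: "nat \<Rightarrow> nat \<Rightarrow> nat \<Rightarrow> bool" where
  "sun_adj m a b \<longleftrightarrow> a < b \<and> b \<le> 2 * m \<and> (b = a + 1 \<or> even a \<and> b = a + 2 \<or> a = 0 \<and> b = 2 * m)"

definition sun_edges :: "nat \<Rightarrow> nat set set" where
  "sun_edges m = {{a, b} |a b. sun_adj m a b}"

lemma doubleton_sun_edges: "{a, b} \<in> sun_edges m \<longleftrightarrow> sun_adj m a b \<or> sun_adj m b a"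
  by (auto simp: sun_edges_def doubleton_eq_iff)

lemma sun_simple: "simple_graph {..<2 * m + 1} (sun_edges m)"
  by (auto simp: simple_graph_def sun_edges_def sun_adj_def)

lemma sun_adj_odd_left: "sun_adj m a b \<Longrightarrow> odd a \<Longrightarrow> b = a + 1"
  by (auto simp: sun_adj_def)

lemma sun_adj_odd_right: "sun_adj m a b \<Longrightarrow> odd b \<Longrightarrow> b = a + 1"
  by (auto simp: sun_adj_def)

text \<open>An interval with an inner vertex either ends at the last vertex \<open>2 * m\<close> or
  spans one ear; in the second case the inner vertex is a tip, whose only edge to the right ends at
  \<open>b\<close>.\<close>

lemma sun_adj_noncrossing:
  assumes "sun_adj m a b" "sun_adj m c d" "a < c" "c < b"
  shows "d \<le> b"
proof -
  from assms consider "b = 2 * m" | "even a" "b = a + 2" "c = a + 1" by (auto simp: sun_adj_def)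
  then show ?thesis
  proof cases
    case 1
    then show ?thesis using assms(2) by (simp add: sun_adj_def)
  next
    case 2
    then show ?thesis using sun_adj_odd_left[OF assms(2)] by simp
  qed
qed

lemma sun_outerplanar: "outerplanar {..<2 * m + 1} (sun_edges m)"
  unfolding sun_edges_def
proof (rule noncrossing_graph_outerplanar)
  fix a b c d assume "sun_adj m a b" "sun_adj m c d"
  then show "b \<le> c \<or> d \<le> a \<or> a \<le> c \<and> d \<le> b \<or> c \<le> a \<and> b \<le> d"
    using sun_adj_noncrossing[of m a b c d] sun_adj_noncrossing[of m c d a b] by linarith
qed (auto simp: sun_adj_def)

lemma graph_connected_rooted:
  assumes "\<And>u. u \<in> V \<Longrightarrow> (\<lambda>x y. x \<in> V \<and> y \<in> V \<and> {x, y} \<in> E)\<^sup>*\<^sup>* u r"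
  shows "graph_connected V E"
proof -
  let ?R = "\<lambda>x y. x \<in> V \<and> y \<in> V \<and> {x, y} \<in> E"
  have "symp ?R" by (auto intro!: sympI simp: insert_commute)
  then have "symp ?R\<^sup>*\<^sup>*" by (rule symp_rtranclp)
  then show ?thesis
    unfolding graph_connected_def using assms by (meson rtranclp_trans sympD)
qed

text \<open>\<open>X\<close> is empty or a single vertex, so this covers both clauses of
  biconnectivity. Removing a vertex from the Hamiltonian cycle 0, 1, ..., 2m leaves a path.\<close>

lemma sun_connected_delete:
  assumes "m \<ge> 1" and X: "X \<subseteq> {v}"
  shows "graph_connected ({..<2 * m + 1} - X) (sun_edges m)"
proof -
  let ?V = "{..<2 * m + 1} - X"
  let ?R = "\<lambda>x y. x \<in> ?V \<and> y \<in> ?V \<and> {x, y} \<in> sun_edges m"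
  have down: "?R\<^sup>*\<^sup>* u 0" if "\<And>i. i \<le> u \<Longrightarrow> i \<in> ?V" for u
    using that
  proof (induction u)
    case (Suc u)
    have "?R (Suc u) u"
      using Suc.prems[of u] Suc.prems[of "Suc u"] by (auto simp: doubleton_sun_edges sun_adj_def)
    moreover have "?R\<^sup>*\<^sup>* u 0" using Suc by simp
    ultimately show ?case by (rule converse_rtranclp_into_rtranclp)
  qed simp
  have up: "?R\<^sup>*\<^sup>* u (2 * m)" if "u \<le> 2 * m" "\<And>i. u \<le> i \<Longrightarrow> i \<le> 2 * m \<Longrightarrow> i \<in> ?V" for u
    using that
  proof (induction u rule: inc_induct)
    case (step u)
    have "?R u (Suc u)"
      using step.prems[of u] step.prems[of "Suc u"] step.hyps
      by (auto simp: doubleton_sun_edges sun_adj_def)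
    moreover have "?R\<^sup>*\<^sup>* (Suc u) (2 * m)" using step by simp
    ultimately show ?case by (rule converse_rtranclp_into_rtranclp)
  qed simp
  show ?thesis
  proof (cases "0 \<in> X")
    case True
    show ?thesis
      by (rule graph_connected_rooted[of _ _ "2 * m"], rule up) (use True X in \<open>auto simp: Suc_le_eq\<close>)
  next
    case False
    have close: "?R (2 * m) 0" if "2 * m \<notin> X"
      using that False assms by (auto simp: doubleton_sun_edges sun_adj_def)
    show ?thesis
    proof (rule graph_connected_rooted[of _ _ 0])
      fix u assume u: "u \<in> ?V"
      show "?R\<^sup>*\<^sup>* u 0"
      proof (cases "\<forall>i\<le>u. i \<in> ?V")
        case True
        then show ?thesis by (intro down) blast
      next
        \<comment> \<open>The deleted vertex lies below \<open>u\<close>, so the way up to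
          \<open>2 * m\<close> is intact and the closing edge leads on to 0.\<close>
        case False
        then obtain i where i: "i \<le> u" "i \<in> X" using u by auto
        then have notX: "j \<notin> X" if "u \<le> j" for j
          using \<open>X \<subseteq> {v}\<close> that u by (cases "j = i") auto
        have "?R\<^sup>*\<^sup>* u (2 * m)" by (rule up) (use u notX in auto)
        moreover have "2 * m \<notin> X" using u by (intro notX) auto
        ultimately show ?thesis using close by (simp add: rtranclp.rtrancl_into_rtrancl)
      qed
    qed
  qed
qed

lemma sun_biconnected: "m \<ge> 1 \<Longrightarrow> biconnected {..<2 * m + 1} (sun_edges m)"
  using sun_connected_delete[of m "{}"] sun_connected_delete[of m "{v}" v for v]
  by (simp add: biconnected_def)

text \<open>The odd vertices are \<open>m\<close> tips of ears, each strictly extreme in the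
  drawing, so the bound for lattice points in strictly convex position applies to them.\<close>

lemma sun_area:
  assumes drawing: "convex_grid_drawing {..<2 * m + 1} (sun_edges m) p" and m: "m \<ge> 1"
  shows "int ((m - 1) div 4) ^ 3 \<le> 32 * grid_area {..<2 * m + 1} p"
proof -
  let ?V = "{..<2 * m + 1}"
  define tips where "tips = (\<lambda>j. 2 * j + 1) ` {..<m}"
  have tips: "tips \<subseteq> ?V" "card tips = m" by (auto simp: tips_def card_image inj_on_def)
  have inj: "inj_on p ?V"
    using drawing by (simp add: convex_grid_drawing_def straight_planar_grid_drawing_def)
  have card: "card (p ` tips) = m"
    using tips inj by (metis card_image inj_on_subset)
  have ext: "\<exists>g. \<forall>Q\<in>p ` tips - {P}. g \<bullet> to_plane Q < g \<bullet> to_plane P" if P: "P \<in> p ` tips" for P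
  proof -
    from P obtain j where j: "j < m" "P = p (2 * j + 1)" by (auto simp: tips_def)
    let ?w = "2 * j + 1" and ?a = "2 * j" and ?b = "2 * j + 2"
    have "{?w, ?a} \<in> sun_edges m" "{?w, ?b} \<in> sun_edges m" "{?a, ?b} \<in> sun_edges m"
      using j by (auto simp: doubleton_sun_edges sun_adj_def)
    moreover have "e = {?w, ?a} \<or> e = {?w, ?b}" if "e \<in> sun_edges m" "?w \<in> e" for e
    proof -
      from that obtain x y where "e = {x, y}" "sun_adj m x y" "?w = x \<or> ?w = y" by (auto simp: sun_edges_def)
      then have "?w = x \<and> y = ?b \<or> ?w = y \<and> x = ?a"
        using sun_adj_odd_left[of m ?w y] sun_adj_odd_right[of m x ?w] by auto
      with \<open>e = {x, y}\<close> show ?thesis by auto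
    qed
    ultimately obtain g where g: "\<And>q. q \<in> ?V \<Longrightarrow> q \<noteq> ?w \<Longrightarrow> g \<bullet> to_plane (p q) < g \<bullet> to_plane (p ?w)"
      using ear_tip_supported[OF drawing sun_simple, of ?w ?a ?b] by auto
    have "g \<bullet> to_plane Q < g \<bullet> to_plane P" if "Q \<in> p ` tips - {P}" for Q
    proof -
      from that obtain q where "q \<in> tips" "Q = p q" "q \<noteq> ?w" using j by blast
      then show ?thesis using g[of q] tips j by auto
    qed
    then show ?thesis by blast
  qed
  \<comment> \<open>Taken with \<open>fst\<close> and \<open>snd\<close> for \<open>f\<close>, this
    bounds the spread of the tips by the grid width and height.\<close>
  have range: "f P - f Q \<le> Max ((f \<circ> p) ` ?V) - Min ((f \<circ> p) ` ?V) + 1"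
    if "P \<in> p ` tips" "Q \<in> p ` tips" for f :: "int \<times> int \<Rightarrow> int" and P Q
  proof -
    from that tips have "f P \<in> (f \<circ> p) ` ?V" "f Q \<in> (f \<circ> p) ` ?V" by auto
    then have "f P \<le> Max ((f \<circ> p) ` ?V)" "Min ((f \<circ> p) ` ?V) \<le> f Q" by simp_all
    then show ?thesis by simp
  qed
  have "int ((card (p ` tips) - 1) div 4) ^ 3 \<le> 32 * grid_width ?V p * grid_height ?V p"
  proof (rule strictly_extreme_points_area)
    show "finite (p ` tips)" "p ` tips \<noteq> {}" using tips(2) m by (auto simp: tips_def)
  qed (use ext range in \<open>auto simp: grid_width_def grid_height_def\<close>)
  then show ?thesis by (simp add: card grid_area_def mult.assoc)
qed

theorem theorem1:
  shows "\<exists>c::real. c > 0 \<and>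
    infinite {n::nat. n > 0 \<and>
      (\<exists>E :: nat set set.
         simple_graph {..<n} E \<and> biconnected {..<n} E \<and> outerplanar {..<n} E \<and>
         (\<forall>p :: nat \<Rightarrow> int \<times> int. convex_grid_drawing {..<n} E p \<longrightarrow>
             real_of_int (grid_area {..<n} p) \<ge> c * real n ^ 3))}"
\<comment> \<open>The graphs used have \<open>m = 4 * k + 1\<close>, so that
  \<open>(m - 1) div 4 = k\<close> exactly. Their order is n = 8k + 3 \<le> 11k for k \<ge> 1, and
  k^3 is at most 32 times the area.\<close>
proof (intro exI[of _ "1 / (32 * 11 ^ 3)"] conjI)
  show "0 < 1 / (32 * 11 ^ 3 :: real)" by simp
  let ?good = "{n::nat. n > 0 \<and>
      (\<exists>E :: nat set set.
         simple_graph {..<n} E \<and> biconnected {..<n} E \<and> outerplanar {..<n} E \<and>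
         (\<forall>p :: nat \<Rightarrow> int \<times> int. convex_grid_drawing {..<n} E p \<longrightarrow>
             real_of_int (grid_area {..<n} p) \<ge> 1 / (32 * 11 ^ 3) * real n ^ 3))}"
  have "2 * (4 * k + 1) + 1 \<in> ?good" if k: "k \<ge> 1" for k
  proof -
    let ?m = "4 * k + 1"
    let ?n = "2 * ?m + 1"
    have "1 / (32 * 11 ^ 3) * real ?n ^ 3 \<le> real_of_int (grid_area {..<?n} p)"
      if "convex_grid_drawing {..<?n} (sun_edges ?m) p" for p
    proof -
      have "int k ^ 3 \<le> 32 * grid_area {..<?n} p" using sun_area[OF that] by simp
      then have "real k ^ 3 \<le> 32 * real_of_int (grid_area {..<?n} p)"
        by (metis of_int_le_iff of_int_mult of_int_numeral of_int_of_nat_eq of_int_power)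
      moreover have "real ?n ^ 3 \<le> (11 * real k) ^ 3" using k by (intro power_mono) auto
      ultimately show ?thesis by (simp add: power_mult_distrib)
    qed
    then show ?thesis
      using sun_simple[of ?m] sun_biconnected[of ?m] sun_outerplanar[of ?m] by auto
  qed
  then have "(\<lambda>k. 2 * (4 * k + 1) + 1) ` {1..} \<subseteq> ?good" by (intro image_subsetI) simp
  moreover have "infinite ((\<lambda>k::nat. 2 * (4 * k + 1) + 1) ` {1..})"
    by (subst finite_image_iff) (auto simp: inj_on_def infinite_Ici)
  ultimately show "infinite ?good" by (rule infinite_super)
qed

end
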